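(* Let $P$ be the torsion-free group $\langle a, b \mid (a^2)^b=a^{-2},\ (b^2)^a=b^{-2}\rangle$ and set $x=a^2$, $y=b^2$, $z=(ab)^2$. Let $d$ be any prime and let $t$ and $w$ be any integers. In the group ring $\mathbb{F}_d[P]$ set $$\begin{aligned} h &= \left(1-z^{1-2t}\right)^{d-2},\\ p &= (1+x)(1+y)\left(z^t+z^{1-t}\right)h,\\ q &= z^w\left[(1+x)(x^{-1}+y^{-1})+(1+y^{-1})(1+z^{2t-1})\right]h,\\ r &= z^w\left[(1+y^{-1})(x+y)z^t+(1+x)(z^t+z^{1-t})\right]h,\\ s &= z^{2t-1}+(4+x+x^{-1}+y+y^{-1})h. \end{aligned}$$ Then $p+qa+rb+s\,ab$ is a non-trivial unit in the group ring $\mathbb{F}_d[P]$.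
   Context: Here $g^k$ for group elements $g,k$ denotes conjugation, $g^k=k^{-1}gk$, so the defining relations of $P$ are $b^{-1}a^2b=a^{-2}$ and $a^{-1}b^2a=b^{-2}$. The elements $x,y,z$ of $P$ commute pairwise. $\mathbb{F}_d$ is the field with $d$ elements. A unit of a group ring $K[G]$ ($K$ a field, $G$ a group) is called trivial if it is of the form $\lambda g$ with $\lambda\in K\setminus\{0\}$ and $g\in G$; a non-trivial unit is a (two-sided) invertible element of $K[G]$ that is not of this form. When $d=2$, $h=1$. *)

theory Defs
  imports
    "HOL-Library.Poly_Mapping"
    "HOL-Library.Cardinality"
    "HOL-Computational_Algebra.Primes"
begin

section \<open>Group presentations\<close>

text \<open>A letter \<open>(g, True)\<close> stands for the generator \<open>g\<close>, a letter \<open>(g, False)\<close> for its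
  formal inverse.\<close>

type_synonym 'g gword = "('g \<times> bool) list"

definition gen_word :: "'g \<Rightarrow> 'g gword" where
  "gen_word g = [(g, True)]"

definition inv_word :: "'g gword \<Rightarrow> 'g gword" where
  "inv_word u = rev (map (\<lambda>(g, e). (g, \<not> e)) u)"

definition conj_word :: "'g gword \<Rightarrow> 'g gword \<Rightarrow> 'g gword" where
  "conj_word u v = inv_word v @ u @ v"

text \<open>Each pair \<open>(l, r) \<in> R\<close> is a defining relation \<open>l = r\<close>; \<open>pres_eq R\<close> is the smallest
  congruence on words that contains \<open>R\<close> and the free cancellations.\<close>

inductive pres_eq :: "('g gword \<times> 'g gword) set \<Rightarrow> 'g gword \<Rightarrow> 'g gword \<Rightarrow> bool"
  for R where
  cancel: "pres_eq R (u @ [(g, e), (g, \<not> e)] @ v) (u @ v)"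
| rel: "(l, r) \<in> R \<Longrightarrow> pres_eq R (u @ l @ v) (u @ r @ v)"
| refl: "pres_eq R u u"
| sym: "pres_eq R u v \<Longrightarrow> pres_eq R v u"
| trans: "pres_eq R u v \<Longrightarrow> pres_eq R v w \<Longrightarrow> pres_eq R u w"

lemma equivp_pres_eq: "equivp (pres_eq R)"
  by (intro equivpI reflpI sympI transpI) (auto intro: pres_eq.intros)

lemma pres_eq_context: "pres_eq R u v \<Longrightarrow> pres_eq R (p @ u @ q) (p @ v @ q)"
proof (induction rule: pres_eq.induct)
  case (cancel u g e v)
  show ?case using pres_eq.cancel[of R "p @ u" g e "v @ q"] by simp
next
  case (rel l r u v)
  show ?case using pres_eq.rel[OF rel, of "p @ u" "v @ q"] by simp
qed (auto intro: pres_eq.intros)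

lemma pres_eq_append:
  assumes "pres_eq R u u'" "pres_eq R v v'"
  shows "pres_eq R (u @ v) (u' @ v')"
  using pres_eq_context[OF assms(1), of "[]" v] pres_eq_context[OF assms(2), of u' "[]"]
  by (auto intro: pres_eq.trans)

lemma inv_word_append [simp]: "inv_word (u @ v) = inv_word v @ inv_word u"
  by (simp add: inv_word_def)

lemma inv_word_inv_word [simp]: "inv_word (inv_word u) = u"
  by (induction u) (auto simp: inv_word_def)

lemma pres_eq_left_inverse: "pres_eq R (inv_word u @ u) []"
proof (induction u)
  case Nil
  show ?case by (simp add: inv_word_def pres_eq.refl)
next
  case (Cons c u)
  obtain g e where c: "c = (g, e)" by (cases c)
  have "pres_eq R (inv_word u @ [(g, \<not> e), (g, \<not> \<not> e)] @ u) (inv_word u @ u)"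
    by (rule pres_eq.cancel)
  then show ?case
    using Cons by (auto simp: c inv_word_def intro: pres_eq.trans)
qed

lemma pres_eq_right_inverse: "pres_eq R (u @ inv_word u) []"
  using pres_eq_left_inverse[of R "inv_word u"] by simp

lemma pres_eq_inv_word:
  assumes "pres_eq R u v"
  shows "pres_eq R (inv_word u) (inv_word v)"
proof -
  have "pres_eq R (inv_word u @ v @ inv_word v) (inv_word u)"
    using pres_eq_context[OF pres_eq_right_inverse, of R "inv_word u" v "[]"] by simp
  moreover have "pres_eq R (inv_word u @ u @ inv_word v) (inv_word u @ v @ inv_word v)"
    using assms by (rule pres_eq_context)
  moreover have "pres_eq R (inv_word u @ u @ inv_word v) (inv_word v)"
    using pres_eq_context[OF pres_eq_left_inverse, of R "[]" u "inv_word v"] by simp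
  ultimately show ?thesis
    by (meson pres_eq.sym pres_eq.trans)
qed

section \<open>The Promislow group\<close>

datatype promislow_gen = GenA | GenB

definition promislow_rels :: "(promislow_gen gword \<times> promislow_gen gword) set" where
  "promislow_rels =
    (let a = gen_word GenA; b = gen_word GenB in
      {(conj_word (a @ a) b, inv_word (a @ a)), (conj_word (b @ b) a, inv_word (b @ b))})"

quotient_type promislow = "promislow_gen gword" / "pres_eq promislow_rels"
  by (rule equivp_pres_eq)

text \<open>The group is written additively although it is not abelian: \<open>Poly_Mapping\<close> takes the
  monoid of a monoid ring from class \<open>monoid_add\<close>.\<close>

instantiation promislow :: group_add
begin

lift_definition zero_promislow :: promislow is "[]" .

lift_definition plus_promislow :: "promislow \<Rightarrow> promislow \<Rightarrow> promislow" is "(@)"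
  by (rule pres_eq_append)

lift_definition uminus_promislow :: "promislow \<Rightarrow> promislow" is inv_word
  by (rule pres_eq_inv_word)

definition minus_promislow :: "promislow \<Rightarrow> promislow \<Rightarrow> promislow" where
  "minus_promislow g k = g + (- k)"

instance
proof
  fix g k l :: promislow
  show "g + k + l = g + (k + l)" by transfer (simp add: pres_eq.refl)
  show "0 + g = g" by transfer (simp add: pres_eq.refl)
  show "g + 0 = g" by transfer (simp add: pres_eq.refl)
  show "- g + g = 0" by transfer (rule pres_eq_left_inverse)
  show "g + (- k) = g - k" by (simp add: minus_promislow_def)
qed

end

lift_definition promislow_a :: promislow is "gen_word GenA" .

lift_definition promislow_b :: promislow is "gen_word GenB" .

lemma promislow_relations:
  "- promislow_b + (promislow_a + promislow_a) + promislow_b = - (promislow_a + promislow_a)"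
  "- promislow_a + (promislow_b + promislow_b) + promislow_a = - (promislow_b + promislow_b)"
  using pres_eq.rel[of _ _ promislow_rels "[]" "[]"]
  by (transfer; simp add: promislow_rels_def conj_word_def Let_def)+

section \<open>Group rings\<close>

text \<open>The group ring \<open>K[G]\<close> is the type \<open>'g \<Rightarrow>\<^sub>0 'k\<close> with its convolution product.\<close>

text \<open>\<open>n \<cdot> g\<close> is the power \<open>g\<^sup>n\<close> in multiplicative notation.\<close>

definition int_mult :: "int \<Rightarrow> 'g::group_add \<Rightarrow> 'g" (infixr \<open>\<cdot>\<close> 75) where
  "n \<cdot> g = (if n \<ge> 0 then sum_list (replicate (nat n) g)
           else sum_list (replicate (nat (- n)) (- g)))"

definition of_group :: "'g::group_add \<Rightarrow> 'g \<Rightarrow>\<^sub>0 'k::ring_1" (\<open>\<iota>\<close>) where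
  "\<iota> g = Poly_Mapping.single g 1"

definition two_sided_unit :: "'r::ring_1 \<Rightarrow> bool" where
  "two_sided_unit u \<longleftrightarrow> (\<exists>v. u * v = 1 \<and> v * u = 1)"

definition trivial_unit :: "('g::group_add \<Rightarrow>\<^sub>0 'k::field) \<Rightarrow> bool" where
  "trivial_unit u \<longleftrightarrow> (\<exists>c g. c \<noteq> 0 \<and> u = Poly_Mapping.single g c)"

definition nontrivial_unit :: "('g::group_add \<Rightarrow>\<^sub>0 'k::field) \<Rightarrow> bool" where
  "nontrivial_unit u \<longleftrightarrow> two_sided_unit u \<and> \<not> trivial_unit u"

end

theory Submission
  imports Defs "HOL-Library.Product_Plus"
begin

text \<open>The elements \<open>x\<close>, \<open>y\<close>, \<open>z\<close> generate a normal free abelian subgroup of rank 3, on which \<open>a\<close> and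
  \<open>b\<close> act by sign changes, with cosets \<open>1\<close>, \<open>a\<close>, \<open>b\<close>, \<open>ab\<close>. So the group ring is a crossed product
  over a commutative ring of Laurent polynomials, and one can check in that ring that
  \<open>x\<^sup>-\<^sup>1 p\<^sup>a - x\<^sup>-\<^sup>1 q a - y\<^sup>-\<^sup>1 r b + z\<^sup>-\<^sup>1 s\<^sup>a ab\<close> is a two-sided inverse. With \<open>Z = z\<^sup>1\<^sup>-\<^sup>2\<^sup>t\<close>, the only
  property of \<open>h\<close> that enters is \<open>Z h + Z\<^sup>-\<^sup>1 h\<^sup>a = (Z - 2 + Z\<^sup>-\<^sup>1) h h\<^sup>a\<close>, which follows from
  \<open>(1 - Z)\<^sup>2 h = (1 - Z)\<^sup>d = 1 - Z\<^sup>d\<close> in characteristic \<open>d\<close>. The unit is not trivial because its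
  coefficients at \<open>x ab\<close> and \<open>x\<^sup>-\<^sup>1 ab\<close> are both \<open>1\<close>; that these group elements differ is seen from an
  affine action of the group on \<open>\<int>\<^sup>3\<close>.\<close>

section \<open>Multiples in a noncommutative group\<close>

lemma int_mult_0 [simp]: "0 \<cdot> g = 0"
  by (simp add: int_mult_def)

lemma int_mult_1 [simp]: "1 \<cdot> g = g"
  by (simp add: int_mult_def)

lemma int_mult_uminus: "n \<cdot> (- g) = (- n) \<cdot> g"
  by (simp add: int_mult_def)

lemma int_mult_neg_1 [simp]: "(- 1) \<cdot> g = - g"
  using int_mult_uminus[of 1 g] by simp

lemma sum_list_replicate_Suc_right:
  "sum_list (replicate (Suc n) (g :: 'a::monoid_add)) = sum_list (replicate n g) + g"
proof -
  have "replicate (Suc n) g = replicate n g @ [g]" by (simp add: replicate_append_same)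
  then show ?thesis by (simp only: sum_list_append sum_list.Cons sum_list.Nil add_0_right)
qed

lemma int_mult_plus_1: "(n + 1) \<cdot> g = n \<cdot> g + g"
proof (cases "n \<ge> 0")
  case True
  then have "nat (n + 1) = Suc (nat n)" by simp
  then show ?thesis
    using True by (simp add: int_mult_def sum_list_replicate_Suc_right del: replicate.simps sum_list.Cons)
next
  case False
  then have "nat (- n) = Suc (nat (- (n + 1)))" by simp
  then have "n \<cdot> g = sum_list (replicate (nat (- (n + 1))) (- g)) + - g"
    using False by (simp only: int_mult_def sum_list_replicate_Suc_right if_False)
  \<comment> \<open>At \<open>n = -1\<close> the number \<open>n + 1\<close> falls into the
    nonnegative branch of the definition; both branches then give the empty sum.\<close>
  moreover have "(n + 1) \<cdot> g = sum_list (replicate (nat (- (n + 1))) (- g))"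
    using False by (cases "n = -1") (auto simp: int_mult_def)
  ultimately show ?thesis by (simp add: add.assoc)
qed

lemma int_mult_minus_1: "(n - 1) \<cdot> g = n \<cdot> g - g"
  using int_mult_plus_1[of "n - 1" g] by simp

lemma int_mult_add: "(m + n) \<cdot> g = m \<cdot> g + n \<cdot> g"
proof (induction n rule: int_induct[where k = 0])
  case (step1 i)
  then show ?case using int_mult_plus_1[of "m + i" g] by (simp add: int_mult_plus_1 add.assoc)
next
  case (step2 i)
  then show ?case using int_mult_minus_1[of "m + i" g]
    by (simp add: int_mult_minus_1 add_diff_eq diff_add_eq add.assoc)
qed simp

lemma int_mult_2: "2 \<cdot> g = g + g"
  using int_mult_plus_1[of 1 g] by simp

text \<open>The equation \<open>k + g = g + l\<close> says that \<open>l\<close> is the conjugate of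
  \<open>k\<close> by \<open>g\<close>. In this form conjugates can be inverted, multiplied and
  raised to powers by associativity alone.\<close>

lemma uminus_intertwine:
  assumes "k + g = g + (l :: 'a::group_add)"
  shows "- k + g = g + - l"
proof -
  have "- k + g = - k + (g + l) + - l" by (simp only: add.assoc right_minus add_0_right)
  also have "\<dots> = - k + (k + g) + - l" by (simp only: assms)
  finally show ?thesis by simp
qed

lemma intertwine_uminus:
  assumes "k + g = g + (l :: 'a::group_add)"
  shows "l + - g = - g + k"
proof -
  have "l + - g = - g + (g + l) + - g" by (simp only: minus_add_cancel)
  also have "\<dots> = - g + (k + g) + - g" by (simp only: assms)
  also have "\<dots> = - g + k" by (simp only: add.assoc right_minus add_0_right)
  finally show ?thesis .
qed

lemma plus_intertwine:
  assumes "k + g = g + l" "k' + g = g + (l' :: 'a::group_add)"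
  shows "(k + k') + g = g + (l + l')"
proof -
  have "(k + k') + g = (k + g) + l'" by (simp only: add.assoc assms(2))
  then show ?thesis by (simp only: assms(1) add.assoc)
qed

lemma int_mult_intertwine:
  assumes "k + g = g + l"
  shows "n \<cdot> k + g = g + n \<cdot> l"
proof (induction n rule: int_induct[where k = 0])
  case (step1 i)
  then show ?case
    using plus_intertwine[OF _ assms, of "i \<cdot> k" "i \<cdot> l"]
    by (simp add: int_mult_plus_1)
next
  case (step2 i)
  then show ?case
    using plus_intertwine[OF _ uminus_intertwine[OF assms], of "i \<cdot> k" "i \<cdot> l"]
    by (simp add: int_mult_minus_1)
qed simp

section \<open>Relations in the Promislow group\<close>

abbreviation "ga \<equiv> promislow_a"
abbreviation "gb \<equiv> promislow_b"
abbreviation "gx \<equiv> 2 \<cdot> promislow_a"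
abbreviation "gy \<equiv> 2 \<cdot> promislow_b"
abbreviation "gz \<equiv> 2 \<cdot> (promislow_a + promislow_b)"

lemma x_a: "gx + ga = ga + gx"
  by (simp add: int_mult_2 add.assoc)
lemma y_b: "gy + gb = gb + gy"
  by (simp add: int_mult_2 add.assoc)
lemma x_b: "gx + gb = gb + - gx"
proof -
  have "2 \<cdot> ga + gb = gb + (- gb + (ga + ga) + gb)"
    by (simp only: int_mult_2 add.assoc add_minus_cancel)
  then show ?thesis by (simp only: promislow_relations int_mult_2)
qed
lemma y_a: "gy + ga = ga + - gy"
proof -
  have "2 \<cdot> gb + ga = ga + (- ga + (gb + gb) + ga)"
    by (simp only: int_mult_2 add.assoc add_minus_cancel)
  then show ?thesis by (simp only: promislow_relations int_mult_2)
qed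

lemma add_intertwine:
  assumes "k + g = g + l" "l + g' = g' + (l' :: 'a::group_add)"
  shows "k + (g + g') = (g + g') + l'"
  by (simp only: assms add.assoc[symmetric]) (simp only: assms add.assoc)

lemma x_ab: "gx + (ga + gb) = (ga + gb) + - gx"
  by (rule add_intertwine[OF x_a x_b])
lemma y_ab: "gy + (ga + gb) = (ga + gb) + - gy"
  by (rule add_intertwine[OF y_a]) (use uminus_intertwine[OF y_b] in simp)
lemma z_ab: "gz + (ga + gb) = (ga + gb) + gz"
  by (simp add: int_mult_2 add.assoc)

text \<open>Conjugating twice by b restores x, so x commutes with b^2 = y. With ab in place of b,
  the same argument shows that x and y commute with z.\<close>

lemma x_y: "gx + gy = gy + gx"
  using add_intertwine[OF x_b uminus_intertwine[OF x_b]] by (simp add: int_mult_2[of gb])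
lemma x_z: "gx + gz = gz + gx"
  using add_intertwine[OF x_ab uminus_intertwine[OF x_ab]] by (simp add: int_mult_2[of "ga + gb"])
lemma y_z: "gy + gz = gz + gy"
  using add_intertwine[OF y_ab uminus_intertwine[OF y_ab]] by (simp add: int_mult_2[of "ga + gb"])

text \<open>Multiplicatively, x^-1 y b^-1 a^-1 = x^-1 b a^-1 = b x a^-1 = ba.\<close>

lemma b_a: "gb + ga = - gx + gy - (ga + gb)"
proof -
  have "- gx + gy - (ga + gb) = - gx + (gy + - gb) + - ga"
    by (simp only: minus_add add.assoc diff_conv_add_uminus)
  also have "\<dots> = (- gx + gb) + - ga"
    by (simp add: int_mult_2[of gb] add.assoc flip: diff_conv_add_uminus)
  also have "\<dots> = (gb + gx) + - ga" using uminus_intertwine[OF x_b] by simp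
  also have "\<dots> = gb + ga" by (simp add: int_mult_2[of ga] add.assoc del: add_uminus_conv_diff)
  finally show ?thesis by simp
qed

text \<open>Conjugating z = (ab)^2 by a gives (ba)^2. With m = x^-1 y and c = ab, \<open>b_a\<close>
  reads ba = m c^-1; since c inverts m, (ba)^2 = m m^-1 c^-2 = z^-1.\<close>

lemma z_a: "gz + ga = ga + - gz"
proof -
  let ?c = "ga + gb" and ?m = "- gx + gy"
  have "?m + ?c = ?c + (gx + - gy)"
    using plus_intertwine[OF uminus_intertwine[OF x_ab] y_ab] by (simp only: minus_minus)
  moreover have "gx + - gy = - ?m"
    using uminus_intertwine[OF x_y] by (simp add: minus_add)
  ultimately have "?m + ?c = ?c + - ?m" by simp
  then have "- ?c + ?m = - ?m + - ?c"
    by (rule intertwine_uminus[symmetric])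
  moreover have "(?m - ?c) + (?m - ?c) = ?m + (- ?c + ?m) + - ?c"
    by (simp only: diff_conv_add_uminus add.assoc)
  ultimately have "(?m - ?c) + (?m - ?c) = ?m + (- ?m + - ?c) + - ?c"
    by simp
  also have "\<dots> = - ?c + - ?c" by (simp only: add_minus_cancel)
  also have "\<dots> = - gz" by (simp only: int_mult_2 minus_add)
  finally have "(gb + ga) + (gb + ga) = - gz" by (simp only: b_a)
  moreover have "gz + ga = ga + ((gb + ga) + (gb + ga))"
    by (simp add: int_mult_2 add.assoc)
  ultimately show ?thesis by simp
qed

text \<open>Write b = a^-1 (ab): conjugation by a^-1 inverts z, and ab commutes with z.\<close>

lemma z_b: "gz + gb = gb + - gz"
proof -
  have "gz + (- ga + (ga + gb)) = (- ga + (ga + gb)) + - gz"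
  proof (rule add_intertwine)
    show "gz + - ga = - ga + - gz"
      using intertwine_uminus[OF uminus_intertwine[OF z_a]] by (simp only: minus_minus)
    show "- gz + (ga + gb) = (ga + gb) + - gz"
      by (rule uminus_intertwine[OF z_ab])
  qed
  then show ?thesis by simp
qed

section \<open>Group rings along maps of groups\<close>

text \<open>The linear extension of \<open>f\<close>; for additive \<open>f\<close> with
  \<open>f 0 = 0\<close> it is a homomorphism of monoid rings. It serves both for the embedding
  along \<open>lat\<close> and for the sign changes.\<close>

definition push :: "('a \<Rightarrow> 'b) \<Rightarrow> ('a \<Rightarrow>\<^sub>0 'c) \<Rightarrow> ('b \<Rightarrow>\<^sub>0 'c::comm_monoid_add)" where
  "push f F = (\<Sum>k\<in>Poly_Mapping.keys F. Poly_Mapping.single (f k) (Poly_Mapping.lookup F k))"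

lemma push_superset:
  assumes "finite A" "Poly_Mapping.keys F \<subseteq> A"
  shows "push f F = (\<Sum>k\<in>A. Poly_Mapping.single (f k) (Poly_Mapping.lookup F k))"
  unfolding push_def using assms by (intro sum.mono_neutral_left) (auto simp: in_keys_iff)

lemma push_zero [simp]: "push f 0 = 0"
  by (simp add: push_def)

lemma push_single [simp]: "push f (Poly_Mapping.single k c) = Poly_Mapping.single (f k) c"
  by (subst push_superset[of "{k}"]) auto

lemma push_add: "push f (F + G) = push f F + push f G"
proof -
  let ?A = "Poly_Mapping.keys F \<union> Poly_Mapping.keys G"
  have "Poly_Mapping.keys (F + G) \<subseteq> ?A" by (rule keys_add)
  then show ?thesis
    by (simp add: push_superset[of ?A] lookup_add single_add sum.distrib)
qed

lemma lookup_push: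
  "Poly_Mapping.lookup (push f F) l =
   (\<Sum>k\<in>Poly_Mapping.keys F. Poly_Mapping.lookup F k when f k = l)"
  by (simp add: push_def lookup_sum lookup_single)

lemma lookup_push_inj:
  assumes "inj f"
  shows "Poly_Mapping.lookup (push f F) (f k) = Poly_Mapping.lookup F k"
proof -
  have "Poly_Mapping.lookup (push f F) (f k) =
      (\<Sum>l\<in>Poly_Mapping.keys F. if l = k then Poly_Mapping.lookup F l else 0)"
    unfolding lookup_push by (intro sum.cong) (auto simp: when_def inj_eq[OF assms])
  then show ?thesis by (simp add: in_keys_iff)
qed

lemma lookup_push_not_range:
  assumes "l \<notin> range f"
  shows "Poly_Mapping.lookup (push f F) l = 0"
  unfolding lookup_push using assms by (intro sum.neutral) (auto simp: when_def)

lemma poly_mapping_add_induct [case_names zero single add]: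
  fixes F :: "'a \<Rightarrow>\<^sub>0 'c::comm_monoid_add"
  assumes "P 0" "\<And>k c. P (Poly_Mapping.single k c)" "\<And>F G. P F \<Longrightarrow> P G \<Longrightarrow> P (F + G)"
  shows "P F"
proof -
  have "P (\<Sum>k\<in>A. Poly_Mapping.single k (Poly_Mapping.lookup F k))" if "finite A" for A
    using that by induction (auto intro: assms)
  moreover have "F = (\<Sum>k\<in>Poly_Mapping.keys F. Poly_Mapping.single k (Poly_Mapping.lookup F k))"
    by (rule poly_mapping_eqI) (auto simp: lookup_sum lookup_single when_def in_keys_iff)
  ultimately show ?thesis by (metis finite_keys)
qed

lemma push_uminus: "push f (- F) = - push f (F :: 'a \<Rightarrow>\<^sub>0 'c::ab_group_add)"
  using push_add[of f F "- F"] by (simp add: minus_unique)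

lemma push_diff: "push f (F - G) = push f F - push f (G :: 'a \<Rightarrow>\<^sub>0 'c::ab_group_add)"
  using push_add[of f F "- G"] by (simp add: push_uminus)

lemma push_mult:
  fixes F G :: "'a::monoid_add \<Rightarrow>\<^sub>0 'c::semiring_0"
  assumes f: "\<And>k l. f (k + l) = f k + (f l :: 'b::monoid_add)"
  shows "push f (F * G) = push f F * push f G"
proof (induction F rule: poly_mapping_add_induct)
  case (single k c)
  show ?case
    by (induction G rule: poly_mapping_add_induct) (simp_all add: mult_single f distrib_left push_add)
qed (simp_all add: distrib_right push_add)

lemma push_one:
  assumes "f (0 :: 'a::monoid_add) = 0"
  shows "push f 1 = (1 :: 'b::monoid_add \<Rightarrow>\<^sub>0 'c::semiring_1)"
  by (metis push_single single_one assms)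

lemma push_numeral:
  assumes "f (0 :: 'a::monoid_add) = 0"
  shows "push f (numeral n) = (numeral n :: 'b::monoid_add \<Rightarrow>\<^sub>0 'c::semiring_1)"
  using push_single[of f 0 "numeral n :: 'c"] assms by simp

lemma push_power:
  fixes F :: "'a::monoid_add \<Rightarrow>\<^sub>0 'c::semiring_1"
  assumes "\<And>k l. f (k + l) = f k + (f l :: 'b::monoid_add)" "f 0 = 0"
  shows "push f (F ^ n) = push f F ^ n"
  using assms by (induction n) (simp_all add: push_one push_mult)

lemma of_group_add: "\<iota> (g + k) = \<iota> g * \<iota> k"
  by (simp add: of_group_def mult_single)

lemma of_group_zero [simp]: "\<iota> 0 = 1"
  by (simp add: of_group_def)

lemma lookup_mult_of_group:
  "Poly_Mapping.lookup (F * \<iota> g) k = Poly_Mapping.lookup F (k - g)"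
proof (induction F rule: poly_mapping_add_induct)
  case (single l c)
  have "l + g = k \<longleftrightarrow> l = k - g" by (auto simp: eq_diff_eq)
  then show ?case by (simp add: of_group_def mult_single lookup_single when_def)
qed (simp_all add: distrib_right lookup_add)

lemma of_group_intertwine:
  assumes "\<And>m. g + f m = f' m + g"
  shows "\<iota> g * push f F = push f' F * \<iota> g"
  by (induction F rule: poly_mapping_add_induct)
    (simp_all add: distrib_left distrib_right push_add of_group_def mult_single assms)

section \<open>The group ring as a crossed product\<close>

text \<open>Exponents of x, y, z. Addition is componentwise, so
  \<open>lattice \<Rightarrow>\<^sub>0 'k\<close> is the Laurent polynomial ring in three
  variables.\<close>

type_synonym lattice = "int \<times> int \<times> int"

fun lat :: "lattice \<Rightarrow> promislow" where
  "lat (i, j, k) = i \<cdot> gx + j \<cdot> gy + k \<cdot> gz"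

fun flip_a :: "lattice \<Rightarrow> lattice" where
  "flip_a (i, j, k) = (i, - j, - k)"

fun flip_b :: "lattice \<Rightarrow> lattice" where
  "flip_b (i, j, k) = (- i, j, - k)"

fun flip_ab :: "lattice \<Rightarrow> lattice" where
  "flip_ab (i, j, k) = (- i, - j, k)"

lemma flip_hom:
  "flip_a (m + n) = flip_a m + flip_a n" "flip_a 0 = 0"
  "flip_b (m + n) = flip_b m + flip_b n" "flip_b 0 = 0"
  "flip_ab (m + n) = flip_ab m + flip_ab n" "flip_ab 0 = 0"
  by (cases m; cases n; simp add: zero_prod_def)+

lemma int_mult_commute:
  assumes "k + g = g + k"
  shows "m \<cdot> k + n \<cdot> g = n \<cdot> g + m \<cdot> k"
  using int_mult_intertwine[OF int_mult_intertwine[OF assms, symmetric], of n m] by simp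

lemma lat_add: "lat (m + n) = lat m + lat n"
proof (cases m; cases n)
  fix i j k i' j' k' assume m: "m = (i, j, k)" and n: "n = (i', j', k')"
  have "k \<cdot> gz + i' \<cdot> gx = i' \<cdot> gx + k \<cdot> gz" "k \<cdot> gz + j' \<cdot> gy = j' \<cdot> gy + k \<cdot> gz"
    "j \<cdot> gy + i' \<cdot> gx = i' \<cdot> gx + j \<cdot> gy"
    by (simp_all add: int_mult_commute x_y x_z y_z)
  then show ?thesis
    unfolding m n by (simp add: int_mult_add) (metis add.assoc)
qed

lemma lat_0: "lat 0 = 0"
  by (simp add: zero_prod_def)

lemma lat_intertwine:
  "lat m + ga = ga + lat (flip_a m)"
  "lat m + gb = gb + lat (flip_b m)"
  "lat m + (ga + gb) = (ga + gb) + lat (flip_ab m)"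
proof -
  obtain i j k where m: "m = (i, j, k)" by (cases m)
  show "lat m + ga = ga + lat (flip_a m)"
    using plus_intertwine[OF plus_intertwine[OF int_mult_intertwine[OF x_a, of i]
        int_mult_intertwine[OF y_a, of j]] int_mult_intertwine[OF z_a, of k]]
    by (simp only: m lat.simps flip_a.simps int_mult_uminus)
  show "lat m + gb = gb + lat (flip_b m)"
    using plus_intertwine[OF plus_intertwine[OF int_mult_intertwine[OF x_b, of i]
        int_mult_intertwine[OF y_b, of j]] int_mult_intertwine[OF z_b, of k]]
    by (simp only: m lat.simps flip_b.simps int_mult_uminus)
  show "lat m + (ga + gb) = (ga + gb) + lat (flip_ab m)"
    using plus_intertwine[OF plus_intertwine[OF int_mult_intertwine[OF x_ab, of i]
        int_mult_intertwine[OF y_ab, of j]] int_mult_intertwine[OF z_ab, of k]]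
    by (simp only: m lat.simps flip_ab.simps int_mult_uminus)
qed

lemma flip_flip [simp]: "flip_a (flip_a m) = m" "flip_b (flip_b m) = m" "flip_ab (flip_ab m) = m"
  by (cases m; simp)+

lemma push_push: "push f (push f' F) = push (f \<circ> f') F"
  by (induction F rule: poly_mapping_add_induct) (simp_all add: push_add)

text \<open>Moving a coset representative to the right of a lattice element conjugates by its
  inverse; as each sign change is an involution, the same flip appears.\<close>

lemma of_group_mult_push_lat:
  fixes F :: "lattice \<Rightarrow>\<^sub>0 'k::ring_1"
  shows "\<iota> ga * push lat F = push lat (push flip_a F) * \<iota> ga"
    "\<iota> gb * push lat F = push lat (push flip_b F) * \<iota> gb"
    "\<iota> (ga + gb) * push lat F = push lat (push flip_ab F) * \<iota> (ga + gb)"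
  unfolding push_push
  by (intro of_group_intertwine; simp only: o_apply lat_intertwine flip_flip)+

abbreviation monomial :: "int \<Rightarrow> int \<Rightarrow> int \<Rightarrow> lattice \<Rightarrow>\<^sub>0 'k::ring_1" where
  "monomial i j k \<equiv> Poly_Mapping.single (i, j, k) 1"

lemma of_group_lat: "\<iota> (lat (i, j, k)) = push lat (monomial i j k)"
  by (simp only: push_single of_group_def)

lemma double_add_self: "- (2 \<cdot> g) + g = - g"
  by (simp add: int_mult_2 minus_add add.assoc)

text \<open>The cocycle of the crossed product: each product of two coset representatives is a
  lattice element times a representative. The product of a and b is itself a representative and
  needs no entry.\<close>

lemma coset_products:
  "ga + ga = lat (1, 0, 0)"
  "ga + (ga + gb) = lat (1, 0, 0) + gb"
  "gb + ga = lat (-1, 1, -1) + (ga + gb)"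
  "gb + gb = lat (0, 1, 0)"
  "gb + (ga + gb) = lat (-1, 0, -1) + ga"
  "(ga + gb) + ga = lat (0, -1, 1) + gb"
  "(ga + gb) + gb = lat (0, -1, 0) + ga"
  "(ga + gb) + (ga + gb) = lat (0, 0, 1)"
proof -
  show aa: "ga + ga = lat (1, 0, 0)" and bb: "gb + gb = lat (0, 1, 0)"
    and cc: "(ga + gb) + (ga + gb) = lat (0, 0, 1)"
    by (simp_all add: int_mult_2)
  show ac: "ga + (ga + gb) = lat (1, 0, 0) + gb"
    by (simp only: aa flip: add.assoc)
  have "- (ga + gb) = lat (0, 0, -1) + (ga + gb)"
    using double_add_self[of "ga + gb"] by simp
  moreover have "- gx + gy = lat (-1, 1, 0)" by simp
  ultimately have "gb + ga = lat (-1, 1, 0) + lat (0, 0, -1) + (ga + gb)"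
    by (simp only: b_a diff_conv_add_uminus add.assoc[of "lat (-1, 1, 0)"])
  then show ba: "gb + ga = lat (-1, 1, -1) + (ga + gb)"
    by (simp only: flip: lat_add) simp
  have "(ga + gb) + gb = ga + lat (0, 1, 0)" by (simp only: add.assoc bb)
  \<comment> \<open>Writing y as the flip of y^-1 lets the conjugation rule move it to the left of
    a.\<close>
  also have "\<dots> = ga + lat (flip_a (0, -1, 0))" by (simp only: flip_a.simps minus_zero minus_minus)
  finally show cb: "(ga + gb) + gb = lat (0, -1, 0) + ga"
    by (simp only: lat_intertwine)
  have "gb + (ga + gb) = lat (-1, 1, -1) + ((ga + gb) + gb)"
    by (simp only: ba flip: add.assoc)
  then have "gb + (ga + gb) = lat (-1, 1, -1) + lat (0, -1, 0) + ga"
    unfolding cb by (simp only: add.assoc)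
  then show "gb + (ga + gb) = lat (-1, 0, -1) + ga" by (simp only: flip: lat_add) simp
  have "(ga + gb) + ga = (ga + lat (flip_a (-1, -1, 1))) + (ga + gb)"
    by (simp only: add.assoc ba flip_a.simps minus_minus)
  then have "(ga + gb) + ga = lat (-1, -1, 1) + (ga + (ga + gb))"
    unfolding lat_intertwine(1)[symmetric] by (simp only: add.assoc)
  then have "(ga + gb) + ga = lat (-1, -1, 1) + lat (1, 0, 0) + gb"
    unfolding ac by (simp only: add.assoc)
  then show "(ga + gb) + ga = lat (0, -1, 1) + gb" by (simp only: flip: lat_add) simp
qed

definition combine where
  "combine P Q R S = push lat P + push lat Q * \<iota> ga + push lat R * \<iota> gb + push lat S * \<iota> (ga + gb)"

text \<open>Moving G to the left of g turns it into G'; the remaining g g' contributes its lattice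
  part as a monomial.\<close>

lemma coset_mult:
  fixes F G :: "lattice \<Rightarrow>\<^sub>0 'k::comm_ring_1"
  assumes "\<iota> g * push lat G = push lat G' * \<iota> g" "g + g' = lat (i, j, k) + l"
  shows "(push lat F * \<iota> g) * (push lat G * \<iota> g') = push lat (F * G' * monomial i j k) * \<iota> l"
proof -
  have "(push lat F * \<iota> g) * (push lat G * \<iota> g') = push lat F * (\<iota> g * push lat G) * \<iota> g'"
    by (simp only: mult.assoc)
  also have "\<dots> = push lat F * push lat G' * \<iota> (g + g')"
    by (simp only: assms(1) mult.assoc of_group_add)
  also have "\<dots> = push lat F * push lat G' * push lat (monomial i j k) * \<iota> l"
    by (simp only: assms(2) mult.assoc of_group_add of_group_lat)
  finally show ?thesis by (simp only: push_mult[OF lat_add])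
qed

lemma combine_mult:
  fixes P Q R S P' Q' R' S' :: "lattice \<Rightarrow>\<^sub>0 'k::comm_ring_1"
  shows "combine P Q R S * combine P' Q' R' S' = combine
    (P * P' + Q * push flip_a Q' * monomial 1 0 0 + R * push flip_b R' * monomial 0 1 0
      + S * push flip_ab S' * monomial 0 0 1)
    (P * Q' + Q * push flip_a P' + R * push flip_b S' * monomial (-1) 0 (-1)
      + S * push flip_ab R' * monomial 0 (-1) 0)
    (P * R' + R * push flip_b P' + Q * push flip_a S' * monomial 1 0 0
      + S * push flip_ab Q' * monomial 0 (-1) 1)
    (P * S' + S * push flip_ab P' + Q * push flip_a R'
      + R * push flip_b Q' * monomial (-1) 1 (-1))"
proof -
  have left: "push lat P * (push lat G * k) = push lat (P * G) * k" for G k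
    by (simp only: push_mult[OF lat_add] mult.assoc)
  have left0: "push lat P * push lat G = push lat (P * G)" for G
    by (simp only: push_mult[OF lat_add])
  \<comment> \<open>The degenerate cases of \<open>coset_mult\<close>: the representatives multiply
    into the lattice (\<open>m0\<close>), the right factor has representative 1 (\<open>m1\<close>),
    or the cocycle is trivial, for a times b (\<open>m2\<close>).\<close>
  have m0: "(push lat F * \<iota> g) * (push lat G * \<iota> g') = push lat (F * G' * monomial i j k)"
    if "\<iota> g * push lat G = push lat G' * \<iota> g" "g + g' = lat (i, j, k)"
    for F G G' :: "lattice \<Rightarrow>\<^sub>0 'k" and g g' i j k
    using coset_mult[of g G G' g' i j k 0 F] that by simp
  have m1: "(push lat F * \<iota> g) * (push lat G) = push lat (F * G') * \<iota> g"
    if "\<iota> g * push lat G = push lat G' * \<iota> g"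
    for F G G' :: "lattice \<Rightarrow>\<^sub>0 'k" and g
    by (simp only: mult.assoc that push_mult[OF lat_add])
  have m2: "(push lat F * \<iota> ga) * (push lat G * \<iota> gb) = push lat (F * push flip_a G) * \<iota> (ga + gb)"
    for F G :: "lattice \<Rightarrow>\<^sub>0 'k"
    using coset_mult[of ga G _ gb 0 0 0 "ga + gb" F, OF of_group_mult_push_lat(1)] lat_0
    by (simp flip: zero_prod_def)
  note A = of_group_mult_push_lat(1) and B = of_group_mult_push_lat(2)
    and C = of_group_mult_push_lat(3) and c = coset_products
  show ?thesis
    unfolding combine_def distrib_left distrib_right left left0
      m1[OF A] m1[OF B] m1[OF C] m0[OF A c(1)] m2 coset_mult[OF A c(2)] coset_mult[OF B c(3)] m0[OF B c(4)]
      coset_mult[OF B c(5)] coset_mult[OF C c(6)] coset_mult[OF C c(7)] m0[OF C c(8)] push_add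
    by (simp only: ac_simps)
qed

lemma combine_1: "combine 1 0 0 0 = 1"
  by (simp add: combine_def push_one lat_0)

section \<open>The affine action on \<open>\<int>\<^sup>3\<close>\<close>

text \<open>The Hantzsche-Wendt crystallographic group, in coordinates doubled to make the half-unit
  translations integral. Reflections such as \<open>1 - j\<close> are involutions, so an inverse
  letter differs only in the direction of its translation.\<close>

fun act_letter :: "promislow_gen \<times> bool \<Rightarrow> lattice \<Rightarrow> lattice" where
  "act_letter (GenA, e) (i, j, k) = ((if e then i + 1 else i - 1), 1 - j, - k)"
| "act_letter (GenB, e) (i, j, k) = (- i, (if e then j + 1 else j - 1), 1 - k)"

lemma act_letter_cancel: "act_letter (g, e) (act_letter (g, \<not> e) m) = m"
  by (cases g; cases m) auto

text \<open>The free cancellations and both defining relations hold for the affine maps, so the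
  action descends to the group.\<close>

lemma foldr_act_letter_eq:
  "pres_eq promislow_rels u v \<Longrightarrow> foldr act_letter u m = foldr act_letter v m"
proof (induction arbitrary: m rule: pres_eq.induct)
  case (cancel u g e v)
  then show ?case using act_letter_cancel[of g e] by simp
next
  case (rel l r u v)
  have "foldr act_letter l n = foldr act_letter r n" for n
    using rel by (cases n)
      (auto simp: promislow_rels_def Let_def conj_word_def inv_word_def gen_word_def)
  then show ?case by simp
qed auto

lift_definition act :: "promislow \<Rightarrow> lattice \<Rightarrow> lattice" is "foldr act_letter"
  by (rule ext) (rule foldr_act_letter_eq)

lemma act_zero [simp]: "act 0 m = m"
  by transfer simp

lemma act_add [simp]: "act (g + k) m = act g (act k m)"
  by transfer simp

lemma act_gens [simp]:
  "act ga (i, j, k) = (i + 1, 1 - j, - k)" "act gb (i, j, k) = (- i, j + 1, 1 - k)"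
  by (transfer, simp add: gen_word_def)+

lemma act_int_mult:
  assumes "\<And>m. act g m = m + (i, j, k)"
  shows "act (n \<cdot> g) m = m + (n * i, n * j, n * k)"
proof -
  have inv: "act (- g) m = m - (i, j, k)" for m
    using act_add[of g "- g" m] assms[of "act (- g) m"] by (simp add: eq_diff_eq)
  show ?thesis
  proof (induction n arbitrary: m rule: int_induct[where k = 0])
    case (step1 n)
    then show ?case by (cases m) (simp add: int_mult_plus_1 assms distrib_right)
  next
    case (step2 n)
    have "act ((n - 1) \<cdot> g) m = act (n \<cdot> g) (act (- g) m)"
      using act_add[of "n \<cdot> g" "- g" m] by (simp add: int_mult_minus_1 del: act_add)
    then show ?case using step2.IH
      by (cases m) (simp add: inv left_diff_distrib)
  qed (simp add: zero_prod_def)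
qed

lemma act_lat: "act (lat (i, j, k)) m = m + (2 * i, 2 * j, - 2 * k)"
proof -
  \<comment> \<open>The element ab sends (i, j, k) to (1 - i, -j, k - 1), whence the negative shift
    for z.\<close>
  have "act gx n = n + (2, 0, 0)" "act gy n = n + (0, 2, 0)" "act gz n = n + (0, 0, - 2)" for n
    by (cases n; simp add: int_mult_2)+
  from this[THEN act_int_mult] show ?thesis by (cases m) simp
qed

lemma inj_lat: "inj lat"
proof (rule injI)
  fix m n assume "lat m = lat n"
  then have "act (lat m) 0 = act (lat n) 0" by simp
  then show "m = n" by (cases m; cases n) (simp add: act_lat zero_prod_def del: lat.simps)
qed

text \<open>Modulo 2, the four cosets of the lattice send the origin to different points.\<close>

lemma lookup_combine_ab:
  "Poly_Mapping.lookup (combine P Q R S) (lat m + (ga + gb)) = Poly_Mapping.lookup S m"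
proof -
  have not_lat: "lat m + (ga + gb) - g \<notin> range lat" if "g \<in> {0, ga, gb}" for g
  proof
    assume "lat m + (ga + gb) - g \<in> range lat"
    then obtain n where "lat m + (ga + gb) = lat n + g"
      by (auto simp: diff_eq_eq simp del: lat.simps)
    then have "act (lat m + (ga + gb)) 0 = act (lat n + g) 0" by simp
    then show False using that
      by (cases m; cases n) (auto simp: act_lat zero_prod_def simp del: lat.simps; presburger)
  qed
  have "Poly_Mapping.lookup (push lat P) (lat m + (ga + gb)) = 0"
    using lookup_push_not_range[OF not_lat[of 0], of P] by simp
  then show ?thesis
    by (simp add: combine_def lookup_add lookup_mult_of_group lookup_push_not_range[OF not_lat]
        lookup_push_inj[OF inj_lat])
qed

section \<open>Powers of \<open>1 - Z\<close>\<close>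

lemma of_group_mono: "monomial i j k = \<iota> (i, j, k)"
  by (simp add: of_group_def)

text \<open>With Z = z^c, the power (1 - Z)^n involves only powers Z^m with m \<ge> 0 and has
  constant term 1. The coefficients at all Z^-l are treated together because multiplying by 1 - Z
  relates the coefficient at Z^-l to that at Z^-(l+1).\<close>

lemma lookup_one_minus_power:
  assumes "c \<noteq> 0"
  shows "i \<noteq> 0 \<or> j \<noteq> 0 \<Longrightarrow> Poly_Mapping.lookup ((1 - monomial 0 0 c) ^ n) (i, j, k) = 0"
    and "Poly_Mapping.lookup ((1 - monomial 0 0 c) ^ n) (0, 0, - (int l * c)) = (if l = 0 then 1 else 0)"
proof -
  have step: "Poly_Mapping.lookup ((1 - monomial 0 0 c) ^ Suc n) (i, j, k) =
      Poly_Mapping.lookup ((1 - monomial 0 0 c) ^ n) (i, j, k) -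
      Poly_Mapping.lookup ((1 - monomial 0 0 c) ^ n) (i, j, k - c)" for n i j k
    by (simp only: power_Suc2 right_diff_distrib mult_1_right lookup_minus of_group_mono
      lookup_mult_of_group) simp
  show "i \<noteq> 0 \<or> j \<noteq> 0 \<Longrightarrow> Poly_Mapping.lookup ((1 - monomial 0 0 c) ^ n) (i, j, k) = 0"
    by (induction n arbitrary: k) (auto simp: step lookup_one zero_prod_def simp del: power_Suc)
  show "Poly_Mapping.lookup ((1 - monomial 0 0 c) ^ n) (0, 0, - (int l * c)) = (if l = 0 then 1 else 0)"
  proof (induction n arbitrary: l)
    case (Suc n)
    have "- (int l * c) - c = - (int (Suc l) * c)" by (simp add: algebra_simps)
    then show ?case by (simp only: step Suc.IH) simp
  qed (use assms in \<open>auto simp: lookup_one zero_prod_def\<close>)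
qed

text \<open>Multiply (1 - Z)^2 h = 1 - Z^d by Q g. On the left, Q (1 - Z)^2 = Z - 2 + Q. On the
  right, Z (1 - Q) = -(1 - Z) gives Z^(d-2) g = -h, hence Z^d g = -Z^2 h.\<close>

lemma conjugate_power_relation:
  fixes Z Q :: "'r::comm_ring_1"
  assumes "prime d" "d = CHAR('r)" "Z * Q = 1"
  defines "h \<equiv> (1 - Z) ^ (d - 2)" and "g \<equiv> (1 - Q) ^ (d - 2)"
  shows "Z * h + Q * g = (Z - 2 + Q) * h * g"
proof -
  have "d \<ge> 2" using assms(1) by (rule prime_ge_2_nat)
  then have d: "d = Suc (Suc (d - 2))" by simp
  \<comment> \<open>For odd d this is clear; d = 2 means characteristic 2, where -1 = 1.\<close>
  have minus1: "(- 1) ^ d = (- 1 :: 'r)"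
  proof (cases "even d")
    case True
    then have "d = 2" using assms(1) primes_dvd_imp_eq two_is_prime_nat by blast
    then have "of_nat 2 = (0 :: 'r)" using assms(2) of_nat_CHAR by metis
    then have "(1 :: 'r) = - 1" by (simp add: eq_neg_iff_add_eq_0)
    then show ?thesis using True by simp
  qed simp
  have "(1 + - Z) ^ d = 1 ^ d + (- Z) ^ d"
    using assms(1,2) by (intro freshmans_dream) auto
  then have h: "(1 - Z) ^ d = 1 - Z ^ d"
    by (subst (asm) power_minus) (simp add: minus1)
  have "Z * (1 - Q) = - (1 - Z)" using assms(3) by (simp add: algebra_simps)
  then have "Z ^ (d - 2) * g = (- 1) ^ (d - 2) * h"
    unfolding g_def h_def
    by (metis power_mult_distrib mult_minus1)
  moreover have "(- 1 :: 'r) ^ (d - 2) = - 1"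
    using minus1 by (subst (asm) d) simp
  ultimately have "Z ^ (d - 2) * g = - h" by simp
  moreover have "Z ^ d = Z * Z * Z ^ (d - 2)" by (subst d) (simp add: mult.assoc)
  ultimately have Zg: "Z ^ d * g = - (Z * Z * h)" by (simp add: mult.assoc)
  have "(1 - Z) * (1 - Z) * h = 1 - Z ^ d"
    unfolding h_def h[symmetric] by (subst (2) d) (simp add: mult.assoc)
  then have "Q * ((1 - Z) * (1 - Z) * h) * g = Q * (1 - Z ^ d) * g"
    by simp
  also have "\<dots> = Q * g - Q * (Z ^ d * g)"
    by (simp add: algebra_simps)
  also have "\<dots> = Q * g + (Z * Q) * (Z * h)" unfolding Zg by (simp add: algebra_simps)
  finally have "Q * ((1 - Z) * (1 - Z)) * h * g = Q * g + Z * h"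
    using assms(3) by (simp add: mult.assoc)
  moreover have "Q * ((1 - Z) * (1 - Z)) = (Z - 2 + Q)"
  proof -
    have "Q * ((1 - Z) * (1 - Z)) = Q - 2 * (Z * Q) + Z * (Z * Q)" by (simp add: algebra_simps)
    then show ?thesis using assms(3) by simp
  qed
  ultimately show ?thesis by (simp add: add.commute)
qed

text \<open>Translation by 1 permutes the ring, so adding 1 to every element leaves the sum of all
  elements unchanged.\<close>

lemma of_nat_CARD_eq_0:
  assumes "finite (UNIV :: 'k::ring_1 set)"
  shows "of_nat CARD('k) = (0 :: 'k)"
proof -
  have "bij (\<lambda>c :: 'k. c + 1)"
    by (rule bij_betw_byWitness[of _ "\<lambda>c. c - 1"]) auto
  then have "(\<Sum>c\<in>UNIV. c + 1) = (\<Sum>c\<in>UNIV. c :: 'k)"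
    by (rule sum.reindex_bij_betw)
  then show ?thesis by (simp add: sum.distrib)
qed

lemma CHAR_eq_CARD_of_prime:
  assumes "prime CARD('k::ring_1)"
  shows "CHAR('k) = CARD('k)"
proof -
  have "finite (UNIV :: 'k set)"
    using assms by (metis card.infinite not_prime_0)
  then have "CHAR('k) dvd CARD('k)"
    by (metis of_nat_CARD_eq_0 of_nat_eq_0_iff_char_dvd)
  moreover have "CHAR('k) \<noteq> 1" by simp
  ultimately show ?thesis using assms by (metis prime_nat_iff)
qed

lemma CHAR_poly_mapping: "CHAR('g::monoid_add \<Rightarrow>\<^sub>0 'k::semiring_1) = CHAR('k)"
proof (rule CHAR_eqI)
  show "of_nat CHAR('k) = (0 :: 'g \<Rightarrow>\<^sub>0 'k)"
    by (metis single_of_nat of_nat_CHAR single_zero)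
  show "CHAR('k) dvd n" if "of_nat n = (0 :: 'g \<Rightarrow>\<^sub>0 'k)" for n
    using that by (metis lookup_of_nat lookup_zero of_nat_eq_0_iff_char_dvd when_simps(1))
qed

section \<open>Laurent polynomial identities\<close>

text \<open>The arguments \<open>xp\<close>, \<open>yp\<close>, \<open>up\<close>, \<open>vp\<close>, \<open>wp\<close> stand for \<open>x\<close>, \<open>y\<close>, \<open>z\<^sup>1\<^sup>-\<^sup>t\<close>, \<open>z\<^sup>t\<close>, \<open>z\<^sup>w\<close>, and \<open>xi\<close>, \<open>yi\<close>, \<open>ui\<close>, \<open>vi\<close>,
  \<open>wi\<close> for their inverses; \<open>g\<close> is \<open>h\<^sup>a = h\<^sup>b\<close>. Passing all of these as arguments makes conjugation by
  \<open>a\<close>, \<open>b\<close> or \<open>ab\<close> a permutation of the arguments.\<close>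

definition coeff_p :: "'r::comm_ring_1 \<Rightarrow> 'r \<Rightarrow> 'r \<Rightarrow> 'r \<Rightarrow> 'r \<Rightarrow> 'r" where
  "coeff_p xp yp up vp h = (1 + xp) * (1 + yp) * (vp + up) * h"

definition coeff_q :: "'r::comm_ring_1 \<Rightarrow> 'r \<Rightarrow> 'r \<Rightarrow> 'r \<Rightarrow> 'r \<Rightarrow> 'r \<Rightarrow> 'r \<Rightarrow> 'r" where
  "coeff_q xp xi yi ui vp wp h = wp * ((1 + xp) * (xi + yi) + (1 + yi) * (1 + vp * ui)) * h"

definition coeff_r :: "'r::comm_ring_1 \<Rightarrow> 'r \<Rightarrow> 'r \<Rightarrow> 'r \<Rightarrow> 'r \<Rightarrow> 'r \<Rightarrow> 'r \<Rightarrow> 'r" where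
  "coeff_r xp yp yi up vp wp h = wp * ((1 + yi) * (xp + yp) * vp + (1 + xp) * (vp + up)) * h"

definition coeff_s :: "'r::comm_ring_1 \<Rightarrow> 'r \<Rightarrow> 'r \<Rightarrow> 'r \<Rightarrow> 'r \<Rightarrow> 'r \<Rightarrow> 'r \<Rightarrow> 'r" where
  "coeff_s xp xi yp yi ui vp h = vp * ui + (4 + xp + xi + yp + yi) * h"

text \<open>Every power of z that depends on t, and z itself, is a product of these variables: z is
  \<open>up * vp\<close> and Z is \<open>up * vi\<close>, with inverse \<open>vp * ui\<close>. Thus
  \<open>rel\<close> is the relation between h and its conjugate.\<close>

locale unit_coeffs =
  fixes xp xi yp yi up ui vp vi wp wi h g :: "'r::comm_ring_1"
  assumes inverses:
      "xi * xp = 1" "yi * yp = 1" "ui * up = 1" "vi * vp = 1" "wi * wp = 1"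
    and rel: "up * vi * h + vp * ui * g = (up * vi - 2 + vp * ui) * h * g"
begin

lemma cancel: "xi * (xp * e) = e" "yi * (yp * e) = e" "ui * (up * e) = e" "vi * (vp * e) = e"
    "wi * (wp * e) = e"
  using inverses by (metis mult.assoc mult_1)+

text \<open>With numerals split into ones, expansion yields plain sums of signed monomials.\<close>

lemma numerals: "(4::'r) = 1 + 1 + 1 + 1" "(2::'r) = 1 + 1"
  by simp_all

lemmas coeff_defs = coeff_p_def coeff_q_def coeff_r_def coeff_s_def

lemmas laurent_simps = ring_distribs mult_minus_left mult_minus_right mult_1_left mult_1_right
  mult_ac inverses cancel minus_add_distrib minus_minus diff_conv_add_uminus

lemma rel_multiple: "e * (up * vi * h + vp * ui * g - (up * vi - 2 + vp * ui) * h * g) = 0"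
  using rel by simp

text \<open>This and the next three identities are the coefficients at 1, a, b, ab given by
  \<open>combine_mult\<close>, with the flips carried out. Those at a and b hold formally; those at
  1 and ab need \<open>rel\<close>.\<close>

lemma right_inverse_1:
  "coeff_p xp yp up vp h * (xi * coeff_p xp yi ui vi g)
    + coeff_q xp xi yi ui vp wp h * - (xi * coeff_q xp xi yp up vi wi g) * xp
    + coeff_r xp yp yi up vp wp h * - (yi * coeff_r xi yp yi ui vi wi g) * yp
    + coeff_s xp xi yp yi ui vp h * (ui * vi * coeff_s xi xp yp yi up vi g) * (up * vp) = 1"
  (is "?l = _")
proof -
  \<comment> \<open>With A = 4 + x + x^-1 + y + y^-1, which every flip fixes, the last summand is
    (Z^-1 + A h)(Z + A g). Its part linear in h and g is A (Z h + Z^-1 g), which forces the cofactor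
    A.\<close>
  have "?l = 1 + (4 + xp + xi + yp + yi) *
      (up * vi * h + vp * ui * g - (up * vi - 2 + vp * ui) * h * g)"
    unfolding coeff_defs numerals by (simp only: laurent_simps) (simp add: add_ac)
  then show ?thesis by (simp only: rel_multiple add_0_right)
qed

lemma right_inverse_a:
  "coeff_p xp yp up vp h * - (xi * coeff_q xp xi yi ui vp wp h)
    + coeff_q xp xi yi ui vp wp h * (xi * coeff_p xp yp up vp h)
    + coeff_r xp yp yi up vp wp h * (up * vp * coeff_s xi xp yi yp ui vp h) * (xi * (ui * vi))
    + coeff_s xp xi yp yi ui vp h * - (yp * coeff_r xi yi yp up vp wp h) * yi = 0"
  unfolding coeff_defs numerals by (simp only: laurent_simps) (simp add: add_ac)

lemma right_inverse_b:
  "coeff_p xp yp up vp h * - (yi * coeff_r xp yp yi up vp wp h)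
    + coeff_r xp yp yi up vp wp h * (xp * coeff_p xi yi up vp h)
    + coeff_q xp xi yi ui vp wp h * (up * vp * coeff_s xp xi yp yi ui vp h) * xp
    + coeff_s xp xi yp yi ui vp h * - (xp * coeff_q xi xp yp ui vp wp h) * (yi * (up * vp)) = 0"
  unfolding coeff_defs numerals by (simp only: laurent_simps) (simp add: add_ac)

lemma right_inverse_ab:
  "coeff_p xp yp up vp h * (ui * vi * coeff_s xp xi yi yp up vi g)
    + coeff_s xp xi yp yi ui vp h * (xp * coeff_p xi yp ui vi g)
    + coeff_q xp xi yi ui vp wp h * - (yp * coeff_r xp yi yp ui vi wi g)
    + coeff_r xp yp yi up vp wp h * - (xp * coeff_q xi xp yi up vi wi g) * (xi * yp * (ui * vi)) = 0"
  (is "?l = _")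
proof -
  \<comment> \<open>The cofactor is read off from the terms linear in h or g; these come only from
    the \<open>p\<close> factors times the h-free or g-free part of the \<open>s\<close>
    factors.\<close>
  have "?l = ((1 + xp) * (1 + yp) * (ui + vi)) *
      (up * vi * h + vp * ui * g - (up * vi - 2 + vp * ui) * h * g)"
    unfolding coeff_defs numerals by (simp only: laurent_simps) (simp add: add_ac)
  then show ?thesis by (simp only: rel_multiple)
qed

text \<open>The four coefficients for the product in the opposite order, where the flips fall on the
  coefficients of the unit. Again only those at 1 and ab use \<open>rel\<close>.\<close>

lemma left_inverse_1:
  "xi * coeff_p xp yi ui vi g * coeff_p xp yp up vp h
    + - (xi * coeff_q xp xi yi ui vp wp h) * coeff_q xp xi yp up vi wi g * xp
    + - (yi * coeff_r xp yp yi up vp wp h) * coeff_r xi yp yi ui vi wi g * yp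
    + ui * vi * coeff_s xp xi yi yp up vi g * coeff_s xi xp yi yp ui vp h * (up * vp) = 1"
  (is "?l = _")
proof -
  have "?l = 1 + (4 + xp + xi + yp + yi) *
      (up * vi * h + vp * ui * g - (up * vi - 2 + vp * ui) * h * g)"
    unfolding coeff_defs numerals by (simp only: laurent_simps) (simp add: add_ac)
  then show ?thesis by (simp only: rel_multiple add_0_right)
qed

lemma left_inverse_a:
  "xi * coeff_p xp yi ui vi g * coeff_q xp xi yi ui vp wp h
    + - (xi * coeff_q xp xi yi ui vp wp h) * coeff_p xp yi ui vi g
    + - (yi * coeff_r xp yp yi up vp wp h) * coeff_s xi xp yp yi up vi g * (xi * (ui * vi))
    + ui * vi * coeff_s xp xi yi yp up vi g * coeff_r xi yi yp up vp wp h * yi = 0"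
  unfolding coeff_defs numerals by (simp only: laurent_simps) (simp add: add_ac)

lemma left_inverse_b:
  "xi * coeff_p xp yi ui vi g * coeff_r xp yp yi up vp wp h
    + - (yi * coeff_r xp yp yi up vp wp h) * coeff_p xi yp ui vi g
    + - (xi * coeff_q xp xi yi ui vp wp h) * coeff_s xp xi yi yp up vi g * xp
    + ui * vi * coeff_s xp xi yi yp up vi g * coeff_q xi xp yp ui vp wp h * (yi * (up * vp)) = 0"
  unfolding coeff_defs numerals by (simp only: laurent_simps) (simp add: add_ac)

lemma left_inverse_ab:
  "xi * coeff_p xp yi ui vi g * coeff_s xp xi yp yi ui vp h
    + ui * vi * coeff_s xp xi yi yp up vi g * coeff_p xi yi up vp h
    + - (xi * coeff_q xp xi yi ui vp wp h) * coeff_r xp yi yp ui vi wi g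
    + - (yi * coeff_r xp yp yi up vp wp h) * coeff_q xi xp yi up vi wi g * (xi * yp * (ui * vi)) = 0"
  (is "?l = _")
proof -
  have "?l = ((1 + xi) * (1 + yi) * (ui + vi)) *
      (up * vi * h + vp * ui * g - (up * vi - 2 + vp * ui) * h * g)"
    unfolding coeff_defs numerals by (simp only: laurent_simps) (simp add: add_ac)
  then show ?thesis by (simp only: rel_multiple)
qed

end

lemma push_coeffs:
  fixes xp :: "lattice \<Rightarrow>\<^sub>0 'k::comm_ring_1" and f :: "lattice \<Rightarrow> lattice"
  assumes "\<And>k l. f (k + l) = f k + f l" "f 0 = 0"
  shows "push f (coeff_p xp yp up vp h) =
      coeff_p (push f xp) (push f yp) (push f up) (push f vp) (push f h)"
    and "push f (coeff_q xp xi yi ui vp wp h) =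
      coeff_q (push f xp) (push f xi) (push f yi) (push f ui) (push f vp) (push f wp) (push f h)"
    and "push f (coeff_r xp yp yi up vp wp h) =
      coeff_r (push f xp) (push f yp) (push f yi) (push f up) (push f vp) (push f wp) (push f h)"
    and "push f (coeff_s xp xi yp yi ui vp h) =
      coeff_s (push f xp) (push f xi) (push f yp) (push f yi) (push f ui) (push f vp) (push f h)"
  by (simp_all only: coeff_p_def coeff_q_def coeff_r_def coeff_s_def push_add push_mult[OF assms(1)]
      push_one[of f, OF assms(2)] push_numeral[of f, OF assms(2)])

theorem theorem3:
  fixes d :: nat
    and t w :: int
    and a b x y z :: promislow
    and h p q r s :: "promislow \<Rightarrow>\<^sub>0 'k::field"
  assumes "prime d"
    and "CARD('k) = d"
    and "a = promislow_a"
    and "b = promislow_b"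
    and "x = 2 \<cdot> a"
    and "y = 2 \<cdot> b"
    and "z = 2 \<cdot> (a + b)"
    and "h = (1 - \<iota> ((1 - 2 * t) \<cdot> z)) ^ (d - 2)"
    and "p = (1 + \<iota> x) * (1 + \<iota> y) * (\<iota> (t \<cdot> z) + \<iota> ((1 - t) \<cdot> z)) * h"
    and "q = \<iota> (w \<cdot> z) *
             ((1 + \<iota> x) * (\<iota> (- x) + \<iota> (- y)) +
              (1 + \<iota> (- y)) * (1 + \<iota> ((2 * t - 1) \<cdot> z))) * h"
    and "r = \<iota> (w \<cdot> z) *
             ((1 + \<iota> (- y)) * (\<iota> x + \<iota> y) * \<iota> (t \<cdot> z) +
              (1 + \<iota> x) * (\<iota> (t \<cdot> z) + \<iota> ((1 - t) \<cdot> z))) * h"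
    and "s = \<iota> ((2 * t - 1) \<cdot> z) + (4 + \<iota> x + \<iota> (- x) + \<iota> y + \<iota> (- y)) * h"
  shows "nontrivial_unit (p + q * \<iota> a + r * \<iota> b + s * \<iota> (a + b))"
proof -

  \<comment> \<open>Variables of the Laurent polynomial ring and their relations\<close>
  define xp xi yp yi :: "lattice \<Rightarrow>\<^sub>0 'k"
    where "xp = monomial 1 0 0" and "xi = monomial (-1) 0 0"
      and "yp = monomial 0 1 0" and "yi = monomial 0 (-1) 0"
  define up ui vp vi wp wi :: "lattice \<Rightarrow>\<^sub>0 'k"
    where "up = monomial 0 0 (1 - t)" and "ui = monomial 0 0 (t - 1)"
      and "vp = monomial 0 0 t" and "vi = monomial 0 0 (- t)"
      and "wp = monomial 0 0 w" and "wi = monomial 0 0 (- w)"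
  define H G :: "lattice \<Rightarrow>\<^sub>0 'k"
    where "H = (1 - monomial 0 0 (1 - 2 * t)) ^ (d - 2)"
      and "G = (1 - monomial 0 0 (2 * t - 1)) ^ (d - 2)"
  note mono_defs = xp_def xi_def yp_def yi_def up_def ui_def vp_def vi_def wp_def wi_def

  have upvi: "up * vi = monomial 0 0 (1 - 2 * t)" and vpui: "vp * ui = monomial 0 0 (2 * t - 1)"
    and upvp: "up * vp = monomial 0 0 1" and uivi: "ui * vi = monomial 0 0 (-1)"
    by (simp_all add: mono_defs mult_single)
  \<comment> \<open>The cocycle monomials of \<open>combine_mult\<close>, in the shape in which they
    occur in the Laurent identities.\<close>
  have products: "xi * (ui * vi) = monomial (-1) 0 (-1)" "yi * (up * vp) = monomial 0 (-1) 1"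
      "xi * yp * (ui * vi) = monomial (-1) 1 (-1)"
    unfolding upvp uivi by (simp_all add: mono_defs mult_single)
  have char: "CHAR(lattice \<Rightarrow>\<^sub>0 'k) = d"
    using assms(1,2) CHAR_eq_CARD_of_prime[where 'k = 'k] by (simp add: CHAR_poly_mapping)
  interpret unit_coeffs xp xi yp yi up ui vp vi wp wi H G
  proof
    show "up * vi * H + vp * ui * G = (up * vi - 2 + vp * ui) * H * G"
      unfolding upvi vpui H_def G_def using assms(1) char
      by (intro conjugate_power_relation) (simp_all add: mult_single flip: zero_prod_def)
  qed (simp_all add: mono_defs mult_single flip: zero_prod_def)

  \<comment> \<open>The sign changes as permutations of the variables\<close>
  have flip_mono:
    "push flip_a xp = xp" "push flip_a xi = xi" "push flip_a yp = yi" "push flip_a yi = yp"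
    "push flip_a up = ui" "push flip_a ui = up" "push flip_a vp = vi" "push flip_a vi = vp"
    "push flip_a wp = wi" "push flip_a wi = wp"
    "push flip_b xp = xi" "push flip_b xi = xp" "push flip_b yp = yp" "push flip_b yi = yi"
    "push flip_b up = ui" "push flip_b ui = up" "push flip_b vp = vi" "push flip_b vi = vp"
    "push flip_b wp = wi" "push flip_b wi = wp"
    "push flip_ab xp = xi" "push flip_ab xi = xp" "push flip_ab yp = yi" "push flip_ab yi = yp"
    "push flip_ab up = up" "push flip_ab ui = ui" "push flip_ab vp = vp" "push flip_ab vi = vi"
    "push flip_ab wp = wp" "push flip_ab wi = wi"
    by (simp_all add: mono_defs)
  have flip_H: "push flip_a H = G" "push flip_a G = H" "push flip_b H = G" "push flip_b G = H"
      "push flip_ab H = H" "push flip_ab G = G"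
    by (simp_all add: H_def G_def push_power push_diff push_one flip_hom)
  note flips = push_mult[OF flip_hom(1)] push_mult[OF flip_hom(3)] push_mult[OF flip_hom(5)]
    push_coeffs[OF flip_hom(1,2)] push_coeffs[OF flip_hom(3,4)] push_coeffs[OF flip_hom(5,6)]
    push_uminus flip_mono flip_H

  define P Q R S where "P = coeff_p xp yp up vp H" and "Q = coeff_q xp xi yi ui vp wp H"
    and "R = coeff_r xp yp yi up vp wp H" and "S = coeff_s xp xi yp yi ui vp H"
  \<comment> \<open>Conjugation by a has been carried out on the arguments, and z^-1 is written as
    \<open>ui * vi\<close>.\<close>
  define P' Q' R' S' where "P' = xi * coeff_p xp yi ui vi G" and "Q' = - (xi * Q)"
    and "R' = - (yi * R)" and "S' = ui * vi * coeff_s xp xi yi yp up vi G"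
  note coeffs = P_def Q_def R_def S_def P'_def Q'_def R'_def S'_def

  \<comment> \<open>Identification of the given element\<close>
  have u: "p + q * \<iota> a + r * \<iota> b + s * \<iota> (a + b) = combine P Q R S"
  proof -
    have neg: "- gx = lat (-1, 0, 0)" "- gy = lat (0, -1, 0)" by simp_all
    have pos: "gx = lat (1, 0, 0)" "gy = lat (0, 1, 0)" by simp_all
    have zz: "n \<cdot> gz = lat (0, 0, n)" for n by simp
    note lat_hom = push_mult[OF lat_add] push_power[OF lat_add lat_0] push_add push_diff
      push_one[of lat, OF lat_0] push_numeral[of lat, OF lat_0]
    have hH: "h = push lat H"
      unfolding assms H_def zz of_group_lat lat_hom ..
    have mono': "\<iota> x = push lat xp" "\<iota> (- x) = push lat xi" "\<iota> y = push lat yp" "\<iota> (- y) = push lat yi"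
      "\<iota> (t \<cdot> z) = push lat vp" "\<iota> ((1 - t) \<cdot> z) = push lat up" "\<iota> (w \<cdot> z) = push lat wp"
      "\<iota> ((2 * t - 1) \<cdot> z) = push lat (vp * ui)"
      unfolding vpui
      unfolding xp_def xi_def yp_def yi_def vp_def up_def wp_def assms(3-7) zz neg of_group_lat
      by (simp_all only: pos of_group_lat)
    show ?thesis
      unfolding combine_def assms(9-12) mono' hH coeffs coeff_defs assms(3,4) lat_hom ..
  qed

  \<comment> \<open>Invertibility on both sides\<close>
  have "combine P Q R S * combine P' Q' R' S' = 1"
    unfolding combine_mult products[symmetric] upvp[symmetric]
      xp_def[symmetric] yp_def[symmetric] yi_def[symmetric] coeffs flips
    by (simp only: right_inverse_1 right_inverse_a right_inverse_b right_inverse_ab combine_1)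
  moreover have "combine P' Q' R' S' * combine P Q R S = 1"
    unfolding combine_mult products[symmetric] upvp[symmetric]
      xp_def[symmetric] yp_def[symmetric] yi_def[symmetric] coeffs flips
    by (simp only: left_inverse_1 left_inverse_a left_inverse_b left_inverse_ab combine_1)
  ultimately have "two_sided_unit (combine P Q R S)"
    unfolding two_sided_unit_def by blast

  \<comment> \<open>Non-triviality\<close>
  moreover have "\<not> trivial_unit (combine P Q R S)"
  proof
    assume "trivial_unit (combine P Q R S)"
    then obtain c g where u: "combine P Q R S = Poly_Mapping.single g c"
      unfolding trivial_unit_def by blast
    have "1 - 2 * t \<noteq> 0" by presburger
    note H_lookup = lookup_one_minus_power[OF this]
    have H: "Poly_Mapping.lookup H (i, j, k) = 0" if "i \<noteq> 0 \<or> j \<noteq> 0" for i j k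
      unfolding H_def using that by (rule H_lookup(1))
    have H0: "Poly_Mapping.lookup H (0, 0, 0) = 1"
      unfolding H_def using H_lookup(2)[of _ 0] by simp
    have S: "S = vp * ui + (H + H + H + H + H * xp + H * xi + H * yp + H * yi)"
      unfolding S_def coeff_s_def by (simp add: algebra_simps)
    \<comment> \<open>Both \<open>H\<close> and \<open>vp * ui\<close> involve powers of z only.
      Hence at x only \<open>H * xp\<close> contributes, with the constant term 1 of
      \<open>H\<close>; at x^-1 only \<open>H * xi\<close> does.\<close>
    have "Poly_Mapping.lookup S (1, 0, 0) = 1" "Poly_Mapping.lookup S (-1, 0, 0) = 1"
      unfolding S vpui xp_def xi_def yp_def yi_def lookup_add of_group_mono lookup_mult_of_group
      by (simp_all add: H H0 zero_prod_def) (simp_all add: of_group_def lookup_single when_def)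
    then have "g = lat (1, 0, 0) + (ga + gb)" "g = lat (-1, 0, 0) + (ga + gb)"
      using lookup_combine_ab[of P Q R S] unfolding u
      by (metis lookup_single_not_eq zero_neq_one)+
    then have "lat (1, 0, 0) = lat (-1, 0, 0)" by (metis add_right_imp_eq)
    then show False using inj_lat by (auto dest!: injD simp del: lat.simps)
  qed
  ultimately show ?thesis unfolding u nontrivial_unit_def by blast
qed

end
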